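(* Let $\lambda$ and $\mu$ be infinite regular cardinals and let $\kappa$ and $\nu$ be infinite cardinals. Then the following three conditions are equivalent. (a) There is a family $(B_{\alpha,\beta})_{\alpha<\mu,\ \beta<\kappa}$ of subsets of $\lambda$ such that: (i) for every $\beta<\kappa$, $\bigcup_{\alpha<\mu} B_{\alpha,\beta}=\lambda$; (ii) for every $\beta<\kappa$ and all $\alpha\le\alpha'<\mu$, $B_{\alpha,\beta}\subseteq B_{\alpha',\beta}$; (iii) for every function $f:\kappa\to\mu$ there exists a subset $F\subseteq\kappa$ with $|F|<\nu$ such that $\left|\bigcap_{\beta\in F} B_{f(\beta),\beta}\right|<\lambda$. (b) Whenever $(X_\beta)_{\beta<\kappa}$ is a family of topological spaces such that no $X_\beta$ is $[\mu,\mu]$-compact, the space $X=\Box^{<\nu}_{\beta<\kappa}X_\beta$ is not $[\lambda,\lambda]$-compact. (c) The topological space $\mu^\kappa$ is not $[\lambda,\lambda]$-compact, where $\mu$ is endowed with the topology whose open sets are exactly the intervals $[0,\alpha)$ for $\alpha\le\mu$, and $\mu^\kappa$ (the product of $\kappa$ copies of $\mu$) is endowed with the $\Box^{<\nu}$ topology.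
   Context: Cardinals are identified with initial ordinals; the Axiom of Choice is assumed. For infinite cardinals $\kappa,\lambda$, a topological space is called $[\kappa,\lambda]$-compact if every open cover of it consisting of at most $\lambda$ sets has a subcover consisting of fewer than $\kappa$ sets. For a cardinal $\nu$ and a family $(X_\beta)_{\beta<\kappa}$ of topological spaces, the $\Box^{<\nu}$ topology on the product $\prod_{\beta<\kappa}X_\beta$ is the topology having as a base all products $\prod_{\beta<\kappa}Y_\beta$ where each $Y_\beta$ is an open subset of $X_\beta$ and $|\{\beta<\kappa : Y_\beta\neq X_\beta\}|<\nu$; the product with this topology is denoted $\Box^{<\nu}_{\beta<\kappa}X_\beta$. No separation axioms are assumed. *)

theory Defs
  imports "HOL-Analysis.Analysis"
begin

unbundle cardinal_syntax

text \<open>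
  A cardinal is given by a relation \<open>r\<close> with \<open>Card_order r\<close>, i.e. a well-order of minimal order type
  on its field. It plays the role of an initial ordinal: the ordinals below it are the elements
  of \<open>Field r\<close>, and \<open>(a, b) \<in> r\<close> means \<open>a \<le> b\<close>.
\<close>

text \<open>
  The property \<open>[\<kappa>,lam]\<close>-compact: since the members of a cover are open sets of \<open>X\<close>, covering means
  that the union equals the space.
\<close>

definition bracket_compact :: "'c rel \<Rightarrow> 'd rel \<Rightarrow> 'a topology \<Rightarrow> bool" where
  "bracket_compact \<kappa> lam X \<longleftrightarrow>
    (\<forall>\<U>. (\<forall>U\<in>\<U>. openin X U) \<and> \<Union>\<U> = topspace X \<and> |\<U>| \<le>o lam \<longrightarrow>
      (\<exists>\<V>\<subseteq>\<U>. \<Union>\<V> = topspace X \<and> |\<V>| <o \<kappa>))"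

definition box_base :: "'n rel \<Rightarrow> 'i set \<Rightarrow> ('i \<Rightarrow> 'a topology) \<Rightarrow> ('i \<Rightarrow> 'a) set set" where
  "box_base \<nu> I X =
    {\<Pi>\<^sub>E i\<in>I. Y i |Y. (\<forall>i\<in>I. openin (X i) (Y i)) \<and> |{i\<in>I. Y i \<noteq> topspace (X i)}| <o \<nu>}"

definition box_topology :: "'n rel \<Rightarrow> 'i set \<Rightarrow> ('i \<Rightarrow> 'a topology) \<Rightarrow> ('i \<Rightarrow> 'a) topology" where
  "box_topology \<nu> I X = topology (arbitrary union_of (\<lambda>U. U \<in> box_base \<nu> I X))"

lemma box_base_Int:
  assumes "Cinfinite \<nu>" "S \<in> box_base \<nu> I X" "T \<in> box_base \<nu> I X"
  shows "S \<inter> T \<in> box_base \<nu> I X"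
proof -
  obtain Y where Y: "S = (\<Pi>\<^sub>E i\<in>I. Y i)" "\<forall>i\<in>I. openin (X i) (Y i)"
    "|{i\<in>I. Y i \<noteq> topspace (X i)}| <o \<nu>"
    using assms(2) unfolding box_base_def by blast
  obtain Z where Z: "T = (\<Pi>\<^sub>E i\<in>I. Z i)" "\<forall>i\<in>I. openin (X i) (Z i)"
    "|{i\<in>I. Z i \<noteq> topspace (X i)}| <o \<nu>"
    using assms(3) unfolding box_base_def by blast
  have "|{i\<in>I. Y i \<noteq> topspace (X i)} \<union> {i\<in>I. Z i \<noteq> topspace (X i)}| <o \<nu>"
    using assms(1) Y(3) Z(3) by (auto intro: card_of_Un_ordLess_infinite_Field simp: cinfinite_def)
  moreover have "{i\<in>I. Y i \<inter> Z i \<noteq> topspace (X i)} \<subseteq>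
      {i\<in>I. Y i \<noteq> topspace (X i)} \<union> {i\<in>I. Z i \<noteq> topspace (X i)}"
    by auto
  ultimately have "|{i\<in>I. Y i \<inter> Z i \<noteq> topspace (X i)}| <o \<nu>"
    using card_of_mono1 ordLeq_ordLess_trans by blast
  moreover have "S \<inter> T = (\<Pi>\<^sub>E i\<in>I. Y i \<inter> Z i)"
    by (simp add: Y(1) Z(1) PiE_Int)
  moreover have "\<forall>i\<in>I. openin (X i) (Y i \<inter> Z i)"
    using Y(2) Z(2) by blast
  ultimately show ?thesis
    unfolding box_base_def by (intro CollectI exI[of _ "\<lambda>i. Y i \<inter> Z i"]) simp
qed

lemma openin_box_topology:
  assumes "Cinfinite \<nu>"
  shows "openin (box_topology \<nu> I X) = arbitrary union_of (\<lambda>U. U \<in> box_base \<nu> I X)"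
  unfolding box_topology_def
  by (intro topology_inverse' istopology_base box_base_Int[OF assms])

lemma topspace_box_topology:
  fixes X :: "'i \<Rightarrow> 'a topology"
  assumes "Cinfinite \<nu>"
  shows "topspace (box_topology \<nu> I X) = (\<Pi>\<^sub>E i\<in>I. topspace (X i))"
proof
  have "U \<subseteq> (\<Pi>\<^sub>E i\<in>I. topspace (X i))" if "U \<in> box_base \<nu> I X" for U
  proof -
    obtain Y where "U = (\<Pi>\<^sub>E i\<in>I. Y i)" "\<forall>i\<in>I. openin (X i) (Y i)"
      using \<open>U \<in> box_base \<nu> I X\<close> unfolding box_base_def by blast
    then show ?thesis
      by (auto intro!: PiE_mono openin_subset)
  qed
  then show "topspace (box_topology \<nu> I X) \<subseteq> (\<Pi>\<^sub>E i\<in>I. topspace (X i))"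
    using openin_topspace[of "box_topology \<nu> I X"]
    unfolding openin_box_topology[OF assms] union_of_def by blast
next
  have "|{} :: 'i set| <o \<nu>"
    using assms by (simp add: cinfinite_def finite_ordLess_infinite Field_card_of card_of_well_order_on card_order_on_well_order_on)
  then have "(\<Pi>\<^sub>E i\<in>I. topspace (X i)) \<in> box_base \<nu> I X"
    unfolding box_base_def by (intro CollectI exI[of _ "\<lambda>i. topspace (X i)"]) simp
  then have "openin (box_topology \<nu> I X) (\<Pi>\<^sub>E i\<in>I. topspace (X i))"
    by (simp add: openin_box_topology[OF assms] arbitrary_union_of_inc)
  then show "(\<Pi>\<^sub>E i\<in>I. topspace (X i)) \<subseteq> topspace (box_topology \<nu> I X)"
    by (rule openin_subset)
qed

text \<open>The open sets are the intervals \<open>[0,\<alpha>)\<close>; the case \<open>U = Field r\<close> is the endpoint \<open>\<alpha> = r\<close>.\<close>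

definition initial_interval_topology :: "'a rel \<Rightarrow> 'a topology" where
  "initial_interval_topology r =
    topology (\<lambda>U. U = Field r \<or> (\<exists>\<alpha>\<in>Field r. U = underS r \<alpha>))"

lemma openin_initial_interval_topology:
  assumes "Well_order r"
  shows "openin (initial_interval_topology r) U \<longleftrightarrow> U = Field r \<or> (\<exists>\<alpha>\<in>Field r. U = underS r \<alpha>)"
proof -
  have r: "wo_rel r"
    using assms by (simp add: wo_rel_def)
  have eq: "(\<lambda>U. U = Field r \<or> (\<exists>\<alpha>\<in>Field r. U = underS r \<alpha>)) = wo_rel.ofilter r"
    by (rule ext) (auto simp: wo_rel.ofilter_underS_Field[OF r])
  have "istopology (wo_rel.ofilter r)"
    unfolding istopology_def wo_rel.ofilter_def[OF r] by blast
  then have "openin (initial_interval_topology r) = wo_rel.ofilter r"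
    unfolding initial_interval_topology_def eq by (rule topology_inverse')
  then show ?thesis
    by (auto simp: wo_rel.ofilter_underS_Field[OF r])
qed

lemma topspace_initial_interval_topology:
  assumes "Well_order r"
  shows "topspace (initial_interval_topology r) = Field r"
proof
  have "openin (initial_interval_topology r) (topspace (initial_interval_topology r))"
    by simp
  then show "topspace (initial_interval_topology r) \<subseteq> Field r"
    unfolding openin_initial_interval_topology[OF assms] by (auto simp: underS_def Field_def)
  show "Field r \<subseteq> topspace (initial_interval_topology r)"
    by (rule openin_subset) (simp add: openin_initial_interval_topology[OF assms])
qed

definition family_condition :: "'l rel \<Rightarrow> 'm rel \<Rightarrow> 'k rel \<Rightarrow> 'n rel \<Rightarrow> bool" where
  "family_condition lam \<mu> \<kappa> \<nu> \<longleftrightarrow>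
    (\<exists>B :: 'm \<Rightarrow> 'k \<Rightarrow> 'l set.
      (\<forall>\<alpha>\<in>Field \<mu>. \<forall>\<beta>\<in>Field \<kappa>. B \<alpha> \<beta> \<subseteq> Field lam) \<and>
      (\<forall>\<beta>\<in>Field \<kappa>. (\<Union>\<alpha>\<in>Field \<mu>. B \<alpha> \<beta>) = Field lam) \<and>
      (\<forall>\<beta>\<in>Field \<kappa>. \<forall>\<alpha> \<alpha>'. (\<alpha>, \<alpha>') \<in> \<mu> \<longrightarrow> B \<alpha> \<beta> \<subseteq> B \<alpha>' \<beta>) \<and>
      (\<forall>f \<in> Field \<kappa> \<rightarrow> Field \<mu>. \<exists>F\<subseteq>Field \<kappa>. |F| <o \<nu> \<and>
        |Field lam \<inter> (\<Inter>\<beta>\<in>F. B (f \<beta>) \<beta>)| <o lam))"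

text \<open>
  A formula can only quantify over the topological spaces carried by subsets of one type.
  This type is made an explicit parameter. On a type with fewer than \<open>\<mu>\<close> elements every space is
  \<open>[\<mu>,\<mu>]\<close>-compact, so the condition holds vacuously there.
\<close>

definition product_condition ::
    "'x itself \<Rightarrow> 'l rel \<Rightarrow> 'm rel \<Rightarrow> 'k rel \<Rightarrow> 'n rel \<Rightarrow> bool" where
  "product_condition (_ :: 'x itself) lam \<mu> \<kappa> \<nu> \<longleftrightarrow>
    (\<forall>X :: 'k \<Rightarrow> 'x topology. (\<forall>\<beta>\<in>Field \<kappa>. \<not> bracket_compact \<mu> \<mu> (X \<beta>)) \<longrightarrow>
      \<not> bracket_compact lam lam (box_topology \<nu> (Field \<kappa>) X))"

definition power_condition :: "'l rel \<Rightarrow> 'm rel \<Rightarrow> 'k rel \<Rightarrow> 'n rel \<Rightarrow> bool" where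
  "power_condition lam \<mu> \<kappa> \<nu> \<longleftrightarrow>
    \<not> bracket_compact lam lam
        (box_topology \<nu> (Field \<kappa>) (\<lambda>_. initial_interval_topology \<mu>))"

end

theory Submission
  imports Defs
begin

text \<open>
  For regular \<open>lam\<close>, failure of \<open>[lam,lam]\<close>-compactness means that there is an increasing open cover
  indexed by \<open>lam\<close> with no member equal to the whole space, and equally that there is a sequence of
  points indexed by \<open>lam\<close> such that every point has a neighbourhood containing fewer than \<open>lam\<close> of
  its terms. Given the family \<open>B\<close> and increasing covers \<open>U \<beta>\<close> of the factors, let the \<open>\<beta>\<close>-th coordinate
  of the \<open>\<xi>\<close>-th point avoid \<open>U \<beta> \<alpha>\<close> for the least \<open>\<alpha>\<close> with \<open>\<xi> \<in> B \<alpha> \<beta>\<close>; this sequence shows that the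
  product is not compact. Conversely, if \<open>O \<xi>\<close> is an increasing cover of \<open>\<mu>\<^sup>\<kappa>\<close> and \<open>p \<xi>\<close> lies
  outside \<open>O \<xi>\<close>, then \<open>B \<alpha> \<beta> = {\<xi>. p \<xi> \<beta> < \<alpha>}\<close> is a family as required.
\<close>

section \<open>Order facts about cardinals and bounded sets in regular cardinals\<close>

lemma Card_orderD:
  assumes "Card_order r"
  shows "Well_order r" "wo_rel r" "trans r" "antisym r" "refl_on (Field r) r"
proof -
  show wo: "Well_order r"
    using card_order_on_well_order_on[OF assms] .
  then show "wo_rel r"
    by (simp add: wo_rel_def)
  show "trans r" "antisym r" "refl_on (Field r) r"
    using wo by (auto simp: order_on_defs)
qed

lemma Card_order_total:
  assumes "Card_order r" "a \<in> Field r" "b \<in> Field r" "(a, b) \<notin> r"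
  shows "(b, a) \<in> r"
proof -
  have "total_on (Field r) r" "refl_on (Field r) r"
    using Card_orderD(1)[OF assms(1)] by (auto simp: order_on_defs)
  then show ?thesis
    using assms(2-4) unfolding total_on_def refl_on_def by metis
qed

text \<open>A set with fewer than \<open>r\<close> elements is not cofinal. Since
  \<open>cofinal\<close> asks for a member strictly above each element, its negation gives an
  \<open>a\<close> with no member of \<open>S\<close> strictly above it, which totality turns into
  an upper bound.\<close>

lemma regularCard_bounded:
  assumes "Card_order r" "regularCard r" "S \<subseteq> Field r" "|S| <o r"
  obtains a where "a \<in> Field r" "\<And>b. b \<in> S \<Longrightarrow> (b, a) \<in> r"
proof -
  have "\<not> cofinal S r"
    using assms not_ordLess_ordIso unfolding regularCard_def by blast
  then obtain a where a: "a \<in> Field r" "\<forall>b\<in>S. a = b \<or> (a, b) \<notin> r"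
    unfolding cofinal_def by blast
  have "(b, a) \<in> r" if "b \<in> S" for b
  proof -
    have "a = b \<or> (a, b) \<notin> r" "b \<in> Field r"
      using a(2) that assms(3) by auto
    then show ?thesis
      using Card_order_total[OF assms(1) a(1)] refl_onD[OF Card_orderD(5)[OF assms(1)]] by metis
  qed
  with a(1) show ?thesis
    using that by blast
qed

section \<open>Failure of compactness in terms of increasing covers and sequences of points\<close>

definition proper_increasing_cover :: "'c rel \<Rightarrow> 'a topology \<Rightarrow> ('c \<Rightarrow> 'a set) \<Rightarrow> bool" where
  "proper_increasing_cover r X U \<longleftrightarrow>
    (\<forall>a\<in>Field r. openin X (U a)) \<and> (\<forall>a b. (a, b) \<in> r \<longrightarrow> U a \<subseteq> U b) \<and>
    (\<Union>a\<in>Field r. U a) = topspace X \<and> (\<forall>a\<in>Field r. U a \<noteq> topspace X)"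

text \<open>Enumerate a bad cover along \<open>r\<close> and take unions over initial segments. As
  \<open>r\<close> is an initial ordinal, each such union uses fewer than \<open>r\<close> members
  of the cover, so it cannot be the whole space.\<close>

lemma not_bracket_compactD:
  assumes r: "Cinfinite r" and X: "\<not> bracket_compact r r X"
  shows "\<exists>U. proper_increasing_cover r X U"
proof -
  have wo: "Well_order r" "trans r" "antisym r"
    using r by (simp_all add: Card_orderD)
  obtain \<U> where \<U>: "\<forall>U\<in>\<U>. openin X U" "\<Union>\<U> = topspace X" "|\<U>| \<le>o r"
    "\<And>\<V>. \<V> \<subseteq> \<U> \<Longrightarrow> \<Union>\<V> = topspace X \<Longrightarrow> \<not> |\<V>| <o r"
    using X unfolding bracket_compact_def by metis
  \<comment> \<open>An enumeration \<open>g\<close> of the cover by \<open>Field r\<close> needs a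
    nonempty cover. An empty cover would be its own subcover with fewer than \<open>r\<close>
    members.\<close>
  have "\<U> \<noteq> {}"
  proof
    assume "\<U> = {}"
    moreover have "|{} :: 'b set set| <o r"
      using r by (simp add: cinfinite_def finite_ordLess_infinite Field_card_of
          card_of_well_order_on card_order_on_well_order_on)
    ultimately show False
      using \<U>(2) \<U>(4)[of "{}"] by simp
  qed
  moreover have "|\<U>| \<le>o |Field r|"
    using ordLeq_ordIso_trans[OF \<U>(3) ordIso_symmetric[OF card_of_Field_ordIso]] r by blast
  ultimately obtain g where g: "g ` Field r = \<U>"
    using card_of_ordLeq2 by metis
  define U where "U a = \<Union> (g ` underS r a)" for a
  have under: "underS r a \<subseteq> Field r" for a
    by (auto simp: underS_def Field_def)
  show ?thesis
    unfolding proper_increasing_cover_def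
  proof (intro exI[of _ U] conjI ballI allI impI)
    show "openin X (U a)" if "a \<in> Field r" for a
      unfolding U_def using under g \<U>(1) by blast
    show "U a \<subseteq> U b" if "(a, b) \<in> r" for a b
      using underS_incr[OF wo(2,3) that] unfolding U_def by blast
    show "(\<Union>a\<in>Field r. U a) = topspace X"
    proof
      show "(\<Union>a\<in>Field r. U a) \<subseteq> topspace X"
        unfolding U_def using under g \<U>(2) by blast
      show "topspace X \<subseteq> (\<Union>a\<in>Field r. U a)"
      proof
        fix x assume "x \<in> topspace X"
        then obtain a where a: "a \<in> Field r" "x \<in> g a"
          unfolding \<U>(2)[symmetric] g[symmetric] by blast
        \<comment> \<open>The segments \<open>underS r b\<close> are strict, so \<open>g a\<close>
          is only contained in \<open>U b\<close> for \<open>b\<close> strictly above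
          \<open>a\<close>. Such a \<open>b\<close> exists because an infinite cardinal is a
          limit.\<close>
        then obtain b where "b \<in> Field r" "a \<noteq> b" "(a, b) \<in> r"
          using Cinfinite_limit[OF _ r] by blast
        then show "x \<in> (\<Union>a\<in>Field r. U a)"
          using a unfolding U_def underS_def by blast
      qed
    qed
    show "U a \<noteq> topspace X" if "a \<in> Field r" for a
    proof
      assume "U a = topspace X"
      moreover have "|g ` underS r a| <o r"
        by (rule ordLeq_ordLess_trans[OF card_of_image card_of_underS]) (use r that in auto)
      moreover have "g ` underS r a \<subseteq> \<U>"
        unfolding g[symmetric] by (rule image_mono[OF under])
      ultimately show False
        using \<U>(4) by (simp add: U_def)
    qed
  qed
qed

text \<open>By regularity the indices of fewer than \<open>r\<close> members are bounded by some
  \<open>a\<close>, so monotonicity puts their union inside the proper subset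
  \<open>U a\<close>.\<close>

lemma not_bracket_compactI:
  assumes r: "Card_order r" "regularCard r"
    and U: "proper_increasing_cover r X U"
  shows "\<not> bracket_compact r r X"
proof
  assume X: "bracket_compact r r X"
  have op: "\<And>a. a \<in> Field r \<Longrightarrow> openin X (U a)"
    and mono: "\<And>a b. (a, b) \<in> r \<Longrightarrow> U a \<subseteq> U b"
    and cov: "(\<Union>a\<in>Field r. U a) = topspace X"
    and ne: "\<And>a. a \<in> Field r \<Longrightarrow> U a \<noteq> topspace X"
    using U unfolding proper_increasing_cover_def by simp_all
  have "|U ` Field r| \<le>o r"
    by (rule ordLeq_ordIso_trans[OF card_of_image card_of_Field_ordIso[OF r(1)]])
  then obtain \<V> where \<V>: "\<V> \<subseteq> U ` Field r" "\<Union>\<V> = topspace X" "|\<V>| <o r"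
    using X[unfolded bracket_compact_def, rule_format, of "U ` Field r"] op cov by blast
  \<comment> \<open>Distinct indices may give the same open set, so one index \<open>s V\<close> is
    chosen for each member of the subcover.\<close>
  have "\<exists>a. a \<in> Field r \<and> V = U a" if "V \<in> \<V>" for V
    using \<V>(1) that by blast
  then obtain s where s: "\<And>V. V \<in> \<V> \<Longrightarrow> s V \<in> Field r \<and> V = U (s V)"
    by metis
  have "|s ` \<V>| <o r"
    by (rule ordLeq_ordLess_trans[OF card_of_image \<V>(3)])
  then obtain a where a: "a \<in> Field r" "\<And>b. b \<in> s ` \<V> \<Longrightarrow> (b, a) \<in> r"
    using regularCard_bounded[OF r, of "s ` \<V>"] s by blast
  have "\<Union>\<V> \<subseteq> U a"
    using s a(2) mono by blast
  then show False
    using \<V>(2) ne[OF a(1)] op[OF a(1)] openin_subset by blast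
qed

lemma not_bracket_compact_pointsI:
  assumes r: "Card_order r" "regularCard r"
    and p: "\<And>a. a \<in> Field r \<Longrightarrow> p a \<in> topspace X"
    and nbhd: "\<And>x. x \<in> topspace X \<Longrightarrow>
      \<exists>N. openin X N \<and> x \<in> N \<and> |{a \<in> Field r. p a \<in> N}| <o r"
    and inf: "infinite (Field r)"
  shows "\<not> bracket_compact r r X"
proof -
  have tr: "trans r" and rf: "refl_on (Field r) r" and as: "antisym r"
    using r(1) by (simp_all add: Card_orderD)
  \<comment> \<open>\<open>U a\<close> is the largest open set that misses the tail of the sequence
    from \<open>a\<close> on. It is proper because it misses \<open>p a\<close> itself.\<close>
  define U where "U a = \<Union> {N. openin X N \<and> (\<forall>b. (a, b) \<in> r \<longrightarrow> p b \<notin> N)}" for a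
  have "proper_increasing_cover r X U"
    unfolding proper_increasing_cover_def
  proof (intro conjI ballI allI impI)
    show "openin X (U a)" if "a \<in> Field r" for a
      unfolding U_def by blast
    show "U a \<subseteq> U b" if "(a, b) \<in> r" for a b
      using that transD[OF tr] unfolding U_def by blast
    show "U a \<noteq> topspace X" if "a \<in> Field r" for a
      using p[OF that] that refl_onD[OF rf that] unfolding U_def by blast
    show "(\<Union>a\<in>Field r. U a) = topspace X"
    proof
      show "(\<Union>a\<in>Field r. U a) \<subseteq> topspace X"
        unfolding U_def using openin_subset by blast
      show "topspace X \<subseteq> (\<Union>a\<in>Field r. U a)"
      proof
        fix x assume "x \<in> topspace X"
        then obtain N where N: "openin X N" "x \<in> N" "|{a \<in> Field r. p a \<in> N}| <o r"
          using nbhd by blast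
        obtain a where a: "a \<in> Field r" "\<And>b. b \<in> {a \<in> Field r. p a \<in> N} \<Longrightarrow> (b, a) \<in> r"
          using regularCard_bounded[OF r _ N(3)] by blast
        \<comment> \<open>The term at the bound \<open>a\<close> may still lie in \<open>N\<close>;
          only a tail that starts strictly above \<open>a\<close> is certain to avoid
          \<open>N\<close>.\<close>
        obtain c where c: "c \<in> Field r" "a \<noteq> c" "(a, c) \<in> r"
          using infinite_Card_order_limit[OF r(1) inf a(1)] by blast
        have "p b \<notin> N" if "(c, b) \<in> r" for b
        proof
          assume "p b \<in> N"
          then have "(b, a) \<in> r"
            using a(2) that by (auto simp: Field_def)
          then have "(c, a) \<in> r"
            using that transD[OF tr] by blast
          then show False
            using c antisymD[OF as] by blast
        qed
        then show "x \<in> (\<Union>a\<in>Field r. U a)"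
          unfolding U_def using N(1,2) c(1) by blast
      qed
    qed
  qed
  then show ?thesis
    by (rule not_bracket_compactI[OF r])
qed

section \<open>From the family of subsets to products of non-compact spaces\<close>

text \<open>The points are chosen so that the \<beta>-th coordinate of \<open>p \<xi>\<close> lies
  in \<open>U \<beta> \<alpha>\<close> only if \<xi> lies in \<open>B \<alpha> \<beta>\<close>. A
  box with sides \<open>U \<beta> (f \<beta>)\<close> for \<beta> in \<open>F\<close> then contains
  \<open>p \<xi>\<close> only for \<xi> in the intersection of the sets
  \<open>B (f \<beta>) \<beta>\<close>, which (iii) makes small.\<close>

lemma family_imp_product_condition:
  fixes lam :: "'l rel" and \<mu> :: "'m rel" and \<kappa> :: "'k rel" and \<nu> :: "'n rel"
  assumes lam: "Cinfinite lam" "regularCard lam" and \<mu>: "Cinfinite \<mu>" and \<nu>: "Cinfinite \<nu>"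
    and fam: "family_condition lam \<mu> \<kappa> \<nu>"
  shows "product_condition TYPE('x) lam \<mu> \<kappa> \<nu>"
  unfolding product_condition_def
proof (intro allI impI)
  fix X :: "'k \<Rightarrow> 'x topology"
  assume X: "\<forall>\<beta>\<in>Field \<kappa>. \<not> bracket_compact \<mu> \<mu> (X \<beta>)"
  obtain B :: "'m \<Rightarrow> 'k \<Rightarrow> 'l set" where
    Bcov: "\<forall>\<beta>\<in>Field \<kappa>. (\<Union>\<alpha>\<in>Field \<mu>. B \<alpha> \<beta>) = Field lam"
    and Bmono: "\<forall>\<beta>\<in>Field \<kappa>. \<forall>\<alpha> \<alpha>'. (\<alpha>, \<alpha>') \<in> \<mu> \<longrightarrow> B \<alpha> \<beta> \<subseteq> B \<alpha>' \<beta>"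
    and Bsmall: "\<forall>f \<in> Field \<kappa> \<rightarrow> Field \<mu>. \<exists>F\<subseteq>Field \<kappa>. |F| <o \<nu> \<and>
        |Field lam \<inter> (\<Inter>\<beta>\<in>F. B (f \<beta>) \<beta>)| <o lam"
    using fam unfolding family_condition_def by blast
  have "\<forall>\<beta>\<in>Field \<kappa>. \<exists>U. proper_increasing_cover \<mu> (X \<beta>) U"
    using X by (intro ballI not_bracket_compactD[OF \<mu>]) blast
  then obtain U where cover: "\<forall>\<beta>\<in>Field \<kappa>. proper_increasing_cover \<mu> (X \<beta>) (U \<beta>)"
    by metis
  have U: "\<And>\<beta> a. \<beta> \<in> Field \<kappa> \<Longrightarrow> a \<in> Field \<mu> \<Longrightarrow> openin (X \<beta>) (U \<beta> a)"
    "\<And>\<beta> a b. \<beta> \<in> Field \<kappa> \<Longrightarrow> (a, b) \<in> \<mu> \<Longrightarrow> U \<beta> a \<subseteq> U \<beta> b"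
    "\<And>\<beta>. \<beta> \<in> Field \<kappa> \<Longrightarrow> (\<Union>a\<in>Field \<mu>. U \<beta> a) = topspace (X \<beta>)"
    "\<And>\<beta> a. \<beta> \<in> Field \<kappa> \<Longrightarrow> a \<in> Field \<mu> \<Longrightarrow> U \<beta> a \<noteq> topspace (X \<beta>)"
    using cover unfolding proper_increasing_cover_def by simp_all
  have wo: "wo_rel \<mu>"
    using \<mu> by (simp add: Card_orderD)
  have "\<exists>y. y \<in> topspace (X \<beta>) \<and> (\<forall>\<alpha>\<in>Field \<mu>. y \<in> U \<beta> \<alpha> \<longrightarrow> \<xi> \<in> B \<alpha> \<beta>)"
    if \<beta>: "\<beta> \<in> Field \<kappa>" and \<xi>: "\<xi> \<in> Field lam" for \<beta> \<xi>
  proof -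
    obtain \<alpha> where \<alpha>: "\<alpha> \<in> Field \<mu>" "\<xi> \<in> B \<alpha> \<beta>"
      using Bcov \<beta> \<xi> by blast
    define a where "a = wo_rel.minim \<mu> {\<alpha>\<in>Field \<mu>. \<xi> \<in> B \<alpha> \<beta>}"
    have a: "a \<in> Field \<mu>" "\<xi> \<in> B a \<beta>"
      using wo_rel.minim_in[OF wo, of "{\<alpha>\<in>Field \<mu>. \<xi> \<in> B \<alpha> \<beta>}"] \<alpha> unfolding a_def by auto
    \<comment> \<open>A point outside \<open>U \<beta> a\<close> can lie in
      \<open>U \<beta> \<alpha>'\<close> only for \<alpha>' above \<open>a\<close>, and there \<xi>
      still belongs to the increasing sets \<open>B\<close>.\<close>
    obtain y where y: "y \<in> topspace (X \<beta>)" "y \<notin> U \<beta> a"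
      using U(4)[OF \<beta> a(1)] U(1)[OF \<beta> a(1)] openin_subset by blast
    have "\<xi> \<in> B \<alpha>' \<beta>" if "\<alpha>' \<in> Field \<mu>" "y \<in> U \<beta> \<alpha>'" for \<alpha>'
    proof -
      have "(\<alpha>', a) \<notin> \<mu>"
        using U(2)[OF \<beta>] y(2) that(2) by blast
      then have "(a, \<alpha>') \<in> \<mu>"
        using Card_order_total[of \<mu>] \<mu> that(1) a(1) by blast
      then show ?thesis
        using Bmono \<beta> a(2) by blast
    qed
    with y(1) show ?thesis by blast
  qed
  then obtain q where q: "\<And>\<beta> \<xi>. \<beta> \<in> Field \<kappa> \<Longrightarrow> \<xi> \<in> Field lam \<Longrightarrow> q \<beta> \<xi> \<in> topspace (X \<beta>)"
    "\<And>\<beta> \<xi> \<alpha>. \<beta> \<in> Field \<kappa> \<Longrightarrow> \<xi> \<in> Field lam \<Longrightarrow> \<alpha> \<in> Field \<mu> \<Longrightarrow> q \<beta> \<xi> \<in> U \<beta> \<alpha> \<Longrightarrow> \<xi> \<in> B \<alpha> \<beta>"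
    by metis
  define p where "p \<xi> = (\<lambda>\<beta>\<in>Field \<kappa>. q \<beta> \<xi>)" for \<xi>
  show "\<not> bracket_compact lam lam (box_topology \<nu> (Field \<kappa>) X)"
  proof (rule not_bracket_compact_pointsI[of _ p])
    show "p \<xi> \<in> topspace (box_topology \<nu> (Field \<kappa>) X)" if "\<xi> \<in> Field lam" for \<xi>
      using q(1) that by (simp add: topspace_box_topology[OF \<nu>] p_def)
  next
    fix x assume "x \<in> topspace (box_topology \<nu> (Field \<kappa>) X)"
    then have x: "x \<in> (\<Pi>\<^sub>E \<beta>\<in>Field \<kappa>. topspace (X \<beta>))"
      by (simp add: topspace_box_topology[OF \<nu>])
    then have "\<exists>\<alpha>. \<alpha> \<in> Field \<mu> \<and> x \<beta> \<in> U \<beta> \<alpha>" if "\<beta> \<in> Field \<kappa>" for \<beta>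
      using U(3)[OF that] that by blast
    \<comment> \<open>For each coordinate, \<open>f\<close> records a member of the increasing cover
      that contains \<open>x \<beta>\<close>. Condition (iii) for this \<open>f\<close> supplies the
      set \<open>F\<close> of coordinates to restrict.\<close>
    then obtain f where f: "\<And>\<beta>. \<beta> \<in> Field \<kappa> \<Longrightarrow> f \<beta> \<in> Field \<mu> \<and> x \<beta> \<in> U \<beta> (f \<beta>)"
      by metis
    then obtain F where F: "F \<subseteq> Field \<kappa>" "|F| <o \<nu>"
      "|Field lam \<inter> (\<Inter>\<beta>\<in>F. B (f \<beta>) \<beta>)| <o lam"
      using Bsmall[rule_format, of f] by blast
    define Y where "Y \<beta> = (if \<beta> \<in> F then U \<beta> (f \<beta>) else topspace (X \<beta>))" for \<beta>
    have "{\<beta> \<in> Field \<kappa>. Y \<beta> \<noteq> topspace (X \<beta>)} \<subseteq> F"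
      by (auto simp: Y_def)
    then have "|{\<beta> \<in> Field \<kappa>. Y \<beta> \<noteq> topspace (X \<beta>)}| <o \<nu>"
      by (rule ordLeq_ordLess_trans[OF card_of_mono1 F(2)])
    moreover have "\<forall>\<beta>\<in>Field \<kappa>. openin (X \<beta>) (Y \<beta>)"
      using U(1) f by (simp add: Y_def)
    ultimately have "PiE (Field \<kappa>) Y \<in> box_base \<nu> (Field \<kappa>) X"
      unfolding box_base_def by blast
    then have "openin (box_topology \<nu> (Field \<kappa>) X) (PiE (Field \<kappa>) Y)"
      by (simp add: openin_box_topology[OF \<nu>] arbitrary_union_of_inc)
    moreover have "x \<in> PiE (Field \<kappa>) Y"
      using x f by (auto simp: Y_def PiE_iff)
    moreover have "{\<xi> \<in> Field lam. p \<xi> \<in> PiE (Field \<kappa>) Y} \<subseteq> Field lam \<inter> (\<Inter>\<beta>\<in>F. B (f \<beta>) \<beta>)"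
    proof (intro subsetI IntI INT_I)
      fix \<xi> \<beta> assume \<xi>: "\<xi> \<in> {\<xi> \<in> Field lam. p \<xi> \<in> PiE (Field \<kappa>) Y}" and \<beta>: "\<beta> \<in> F"
      then have "p \<xi> \<beta> \<in> Y \<beta>"
        using F(1) by blast
      then have "q \<beta> \<xi> \<in> U \<beta> (f \<beta>)"
        using \<beta> F(1) by (auto simp: p_def Y_def)
      then show "\<xi> \<in> B (f \<beta>) \<beta>"
        using q(2) \<beta> F(1) \<xi> f by blast
    qed blast
    then have "|{\<xi> \<in> Field lam. p \<xi> \<in> PiE (Field \<kappa>) Y}| <o lam"
      by (rule ordLeq_ordLess_trans[OF card_of_mono1 F(3)])
    ultimately show "\<exists>N. openin (box_topology \<nu> (Field \<kappa>) X) N \<and> x \<in> N \<and>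
        |{\<xi> \<in> Field lam. p \<xi> \<in> N}| <o lam"
      by blast
  qed (use lam in \<open>auto simp: cinfinite_def\<close>)
qed

section \<open>The power of the initial interval space and the way back to the family\<close>

text \<open>The proper initial segments form the required increasing cover, because an infinite
  cardinal has no largest element. Thus the power space is a special case of the products in
  (b).\<close>

lemma initial_interval_not_bracket_compact:
  assumes r: "Cinfinite r" "regularCard r"
  shows "\<not> bracket_compact r r (initial_interval_topology r)"
proof -
  have wo: "Well_order r" and tr: "trans r" and as: "antisym r"
    using r by (simp_all add: Card_orderD)
  have "proper_increasing_cover r (initial_interval_topology r) (underS r)"
    unfolding proper_increasing_cover_def
  proof (intro conjI ballI allI impI)
    show "openin (initial_interval_topology r) (underS r a)" if "a \<in> Field r" for a
      using that by (auto simp: openin_initial_interval_topology[OF wo])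
    show "underS r a \<subseteq> underS r b" if "(a, b) \<in> r" for a b
      using underS_incr[OF tr as that] .
    show "(\<Union>a\<in>Field r. underS r a) = topspace (initial_interval_topology r)"
      unfolding topspace_initial_interval_topology[OF wo]
    proof
      show "(\<Union>a\<in>Field r. underS r a) \<subseteq> Field r"
        by (auto simp: underS_def Field_def)
      show "Field r \<subseteq> (\<Union>a\<in>Field r. underS r a)"
      proof
        fix b assume "b \<in> Field r"
        then obtain a where "a \<in> Field r" "b \<noteq> a" "(b, a) \<in> r"
          using Cinfinite_limit[OF _ r(1)] by blast
        then show "b \<in> (\<Union>a\<in>Field r. underS r a)"
          unfolding underS_def by blast
      qed
    qed
    show "underS r a \<noteq> topspace (initial_interval_topology r)" if "a \<in> Field r" for a
      using that unfolding topspace_initial_interval_topology[OF wo] underS_def by blast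
  qed
  then show ?thesis
    by (rule not_bracket_compactI[rotated 2]) (use r in auto)
qed

text \<open>A function \<open>f\<close> is a point of the power, so some basic box around it lies in
  one \<open>U \<xi>0\<close>. Open sets of the factors are downward closed: if
  \<open>p \<xi>\<close> is below \<open>f\<close> on the restricted coordinates, it lies in the
  box. Since \<open>p \<xi>\<close> avoids \<open>U \<xi>\<close>, this forces \<xi> below
  \<open>\<xi>0\<close>.\<close>

lemma power_imp_family_condition:
  fixes lam :: "'l rel" and \<mu> :: "'m rel" and \<kappa> :: "'k rel" and \<nu> :: "'n rel"
  assumes lam: "Cinfinite lam" and \<mu>: "Cinfinite \<mu>" and \<nu>: "Cinfinite \<nu>"
    and pow: "power_condition lam \<mu> \<kappa> \<nu>"
  shows "family_condition lam \<mu> \<kappa> \<nu>"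
proof -
  have wo: "Well_order \<mu>" and tr: "trans \<mu>" and as: "antisym \<mu>"
    using \<mu> by (simp_all add: Card_orderD)
  let ?I = "initial_interval_topology \<mu>"
  let ?X = "box_topology \<nu> (Field \<kappa>) (\<lambda>_. ?I)"
  have top: "topspace ?X = (\<Pi>\<^sub>E \<beta>\<in>Field \<kappa>. Field \<mu>)"
    by (simp add: topspace_box_topology[OF \<nu>] topspace_initial_interval_topology[OF wo])
  obtain U where "proper_increasing_cover lam ?X U"
    using not_bracket_compactD[OF lam pow[unfolded power_condition_def]] by blast
  then have U: "\<And>a. a \<in> Field lam \<Longrightarrow> openin ?X (U a)"
    "\<And>a b. (a, b) \<in> lam \<Longrightarrow> U a \<subseteq> U b"
    "(\<Union>a\<in>Field lam. U a) = topspace ?X"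
    "\<And>a. a \<in> Field lam \<Longrightarrow> U a \<noteq> topspace ?X"
    unfolding proper_increasing_cover_def by simp_all
  have "\<exists>y. y \<in> topspace ?X \<and> y \<notin> U \<xi>" if "\<xi> \<in> Field lam" for \<xi>
    using U(1)[OF that] U(4)[OF that] openin_subset by blast
  then obtain p where p: "\<And>\<xi>. \<xi> \<in> Field lam \<Longrightarrow> p \<xi> \<in> topspace ?X \<and> p \<xi> \<notin> U \<xi>"
    by metis
  have p\<mu>: "p \<xi> \<beta> \<in> Field \<mu>" if "\<xi> \<in> Field lam" "\<beta> \<in> Field \<kappa>" for \<xi> \<beta>
    using p[OF that(1)] that(2) unfolding top by blast
  define B where "B \<alpha> \<beta> = {\<xi> \<in> Field lam. p \<xi> \<beta> \<in> underS \<mu> \<alpha>}" for \<alpha> \<beta>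
  show ?thesis
    unfolding family_condition_def
  proof (intro exI[of _ B] conjI ballI allI impI)
    show "B \<alpha> \<beta> \<subseteq> Field lam" for \<alpha> \<beta>
      by (auto simp: B_def)
    show "(\<Union>\<alpha>\<in>Field \<mu>. B \<alpha> \<beta>) = Field lam" if \<beta>: "\<beta> \<in> Field \<kappa>" for \<beta>
    proof
      show "Field lam \<subseteq> (\<Union>\<alpha>\<in>Field \<mu>. B \<alpha> \<beta>)"
      proof
        fix \<xi> assume \<xi>: "\<xi> \<in> Field lam"
        obtain \<alpha> where "\<alpha> \<in> Field \<mu>" "p \<xi> \<beta> \<noteq> \<alpha>" "(p \<xi> \<beta>, \<alpha>) \<in> \<mu>"
          using Cinfinite_limit[OF p\<mu>[OF \<xi> \<beta>] \<mu>] by blast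
        then show "\<xi> \<in> (\<Union>\<alpha>\<in>Field \<mu>. B \<alpha> \<beta>)"
          using \<xi> unfolding B_def underS_def by blast
      qed
    qed (auto simp: B_def)
    show "B \<alpha> \<beta> \<subseteq> B \<alpha>' \<beta>" if "(\<alpha>, \<alpha>') \<in> \<mu>" for \<alpha> \<alpha>' \<beta>
      using underS_incr[OF tr as that] unfolding B_def by blast
    fix f assume f: "f \<in> Field \<kappa> \<rightarrow> Field \<mu>"
    \<comment> \<open>Points of the product are extensional functions, so \<open>f\<close> is made
      undefined outside the index set.\<close>
    define f' where "f' = restrict f (Field \<kappa>)"
    have "f' \<in> topspace ?X"
      using f by (simp add: top f'_def)
    then obtain \<xi>0 where \<xi>0: "\<xi>0 \<in> Field lam" "f' \<in> U \<xi>0"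
      using U(3) by blast
    then obtain N where N: "N \<in> box_base \<nu> (Field \<kappa>) (\<lambda>_. ?I)" "f' \<in> N" "N \<subseteq> U \<xi>0"
      using U(1)[OF \<xi>0(1)] unfolding openin_box_topology[OF \<nu>] union_of_def by blast
    then obtain Y where Y: "N = PiE (Field \<kappa>) Y" "\<forall>\<beta>\<in>Field \<kappa>. openin ?I (Y \<beta>)"
      "|{\<beta>\<in>Field \<kappa>. Y \<beta> \<noteq> Field \<mu>}| <o \<nu>"
      unfolding box_base_def topspace_initial_interval_topology[OF wo] by blast
    \<comment> \<open>The set for (iii) is the support of the box, which has fewer than \<nu>
      elements by the definition of the base.\<close>
    let ?F = "{\<beta>\<in>Field \<kappa>. Y \<beta> \<noteq> Field \<mu>}"
    have "Field lam \<inter> (\<Inter>\<beta>\<in>?F. B (f \<beta>) \<beta>) \<subseteq> underS lam \<xi>0"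
    proof
      fix \<xi> assume \<xi>: "\<xi> \<in> Field lam \<inter> (\<Inter>\<beta>\<in>?F. B (f \<beta>) \<beta>)"
      have "p \<xi> \<beta> \<in> Y \<beta>" if \<beta>: "\<beta> \<in> Field \<kappa>" for \<beta>
      proof (cases "Y \<beta> = Field \<mu>")
        case True
        then show ?thesis
          using p\<mu> \<xi> \<beta> by blast
      next
        case False
        then obtain \<alpha> where \<alpha>: "Y \<beta> = underS \<mu> \<alpha>"
          using Y(2) \<beta> openin_initial_interval_topology[OF wo] by blast
        have "p \<xi> \<beta> \<in> underS \<mu> (f \<beta>)"
          using \<xi> \<beta> False by (auto simp: B_def)
        moreover have "f \<beta> \<in> underS \<mu> \<alpha>"
          using N(2) \<beta> unfolding Y(1) \<alpha>[symmetric] f'_def by (auto simp: PiE_iff)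
        ultimately show ?thesis
          using tr as unfolding \<alpha> underS_def by (auto dest: transD antisymD)
      qed
      then have "p \<xi> \<in> N"
        using p[of \<xi>] \<xi> unfolding Y(1) top by (auto simp: PiE_iff)
      then have "p \<xi> \<in> U \<xi>0"
        using N(3) by blast
      \<comment> \<open>Otherwise \<open>U \<xi>0\<close> would be contained in
        \<open>U \<xi>\<close>, which \<open>p \<xi>\<close> avoids.\<close>
      then have "(\<xi>0, \<xi>) \<notin> lam"
        using U(2) p[of \<xi>] \<xi> by blast
      then show "\<xi> \<in> underS lam \<xi>0"
        using Card_orderD(5)[of lam] Card_order_total[of lam] lam \<xi>0(1) \<xi>
        unfolding underS_def refl_on_def by blast
    qed
    then have "|Field lam \<inter> (\<Inter>\<beta>\<in>?F. B (f \<beta>) \<beta>)| <o lam"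
      by (rule ordLeq_ordLess_trans[OF card_of_mono1 card_of_underS[OF _ \<xi>0(1)]]) (use lam in auto)
    with Y(3) show "\<exists>F\<subseteq>Field \<kappa>. |F| <o \<nu> \<and> |Field lam \<inter> (\<Inter>\<beta>\<in>F. B (f \<beta>) \<beta>)| <o lam"
      by (intro exI[of _ ?F]) blast
  qed
qed

section \<open>Transfer between isomorphic cardinals, and the equivalence\<close>

text \<open>Reindex along the isomorphism \<open>h\<close>: surjectivity keeps the unions, order
  preservation keeps monotonicity, and \<open>f\<close> is handled by applying (iii) to
  \<open>h\<close> composed with \<open>f\<close>. This lets \<mu> be replaced by a copy that lives
  on the carrier type of the spaces.\<close>

lemma family_condition_ordIso:
  fixes \<mu> :: "'m rel" and \<mu>' :: "'x rel"
  assumes iso: "\<mu> =o \<mu>'" and fam: "family_condition lam \<mu>' \<kappa> \<nu>"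
  shows "family_condition lam \<mu> \<kappa> \<nu>"
proof -
  obtain h where h: "iso \<mu> \<mu>' h"
    using iso unfolding ordIso_def by blast
  have bij: "h ` Field \<mu> = Field \<mu>'"
    using h unfolding iso_def bij_betw_def by blast
  have mono: "(h a, h b) \<in> \<mu>'" if "(a, b) \<in> \<mu>" for a b
    using iso_forward[OF that h] .
  obtain B where B: "\<forall>\<alpha>\<in>Field \<mu>'. \<forall>\<beta>\<in>Field \<kappa>. B \<alpha> \<beta> \<subseteq> Field lam"
    "\<forall>\<beta>\<in>Field \<kappa>. (\<Union>\<alpha>\<in>Field \<mu>'. B \<alpha> \<beta>) = Field lam"
    "\<forall>\<beta>\<in>Field \<kappa>. \<forall>\<alpha> \<alpha>'. (\<alpha>, \<alpha>') \<in> \<mu>' \<longrightarrow> B \<alpha> \<beta> \<subseteq> B \<alpha>' \<beta>"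
    "\<forall>f \<in> Field \<kappa> \<rightarrow> Field \<mu>'. \<exists>F\<subseteq>Field \<kappa>. |F| <o \<nu> \<and>
        |Field lam \<inter> (\<Inter>\<beta>\<in>F. B (f \<beta>) \<beta>)| <o lam"
    using fam unfolding family_condition_def by blast
  show ?thesis
    unfolding family_condition_def
  proof (intro exI[of _ "\<lambda>\<alpha>. B (h \<alpha>)"] conjI ballI allI impI)
    show "B (h \<alpha>) \<beta> \<subseteq> Field lam" if "\<alpha> \<in> Field \<mu>" "\<beta> \<in> Field \<kappa>" for \<alpha> \<beta>
      using B(1) bij that by blast
    show "(\<Union>\<alpha>\<in>Field \<mu>. B (h \<alpha>) \<beta>) = Field lam" if "\<beta> \<in> Field \<kappa>" for \<beta>
      using B(2) that unfolding bij[symmetric] by simp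
    show "B (h \<alpha>) \<beta> \<subseteq> B (h \<alpha>') \<beta>" if "\<beta> \<in> Field \<kappa>" "(\<alpha>, \<alpha>') \<in> \<mu>" for \<alpha> \<alpha>' \<beta>
      using B(3) that mono by blast
    show "\<exists>F\<subseteq>Field \<kappa>. |F| <o \<nu> \<and> |Field lam \<inter> (\<Inter>\<beta>\<in>F. B (h (f \<beta>)) \<beta>)| <o lam"
      if "f \<in> Field \<kappa> \<rightarrow> Field \<mu>" for f
      using B(4)[rule_format, of "\<lambda>\<beta>. h (f \<beta>)"] that bij by blast
  qed
qed

lemma bracket_compact_ordIso:
  fixes r :: "'c rel" and r' :: "'d rel"
  assumes "r =o r'" "bracket_compact r r X"
  shows "bracket_compact r' r' X"
  unfolding bracket_compact_def
proof (intro allI impI)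
  fix \<U> assume \<U>: "(\<forall>U\<in>\<U>. openin X U) \<and> \<Union>\<U> = topspace X \<and> |\<U>| \<le>o r'"
  then have "|\<U>| \<le>o r"
    using ordLeq_ordIso_trans[OF _ ordIso_symmetric[OF assms(1)]] by blast
  then have "\<exists>\<V>\<subseteq>\<U>. \<Union>\<V> = topspace X \<and> |\<V>| <o r"
    using assms(2) \<U> unfolding bracket_compact_def by simp
  then show "\<exists>\<V>\<subseteq>\<U>. \<Union>\<V> = topspace X \<and> |\<V>| <o r'"
    using ordLess_ordIso_trans[OF _ assms(1)] by metis
qed

text \<open>As (b) refers to one carrier type, its equivalence with (a) is split: (a) gives (b) on
  every type, and the converse is proved on types with room for a copy of \<mu>, whose power is then
  a product in (b).\<close>

theorem theorem5:
  fixes lam :: "'l rel" and \<mu> :: "'m rel" and \<kappa> :: "'k rel" and \<nu> :: "'n rel"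
  assumes "Cinfinite lam" "regularCard lam"
    and "Cinfinite \<mu>" "regularCard \<mu>"
    and "Cinfinite \<kappa>"
    and "Cinfinite \<nu>"
  shows "(family_condition lam \<mu> \<kappa> \<nu> \<longleftrightarrow> power_condition lam \<mu> \<kappa> \<nu>) \<and>
    (family_condition lam \<mu> \<kappa> \<nu> \<longrightarrow> product_condition TYPE('x) lam \<mu> \<kappa> \<nu>) \<and>
    ( |Field \<mu>| \<le>o |UNIV :: 'x set| \<longrightarrow>
      (product_condition TYPE('x) lam \<mu> \<kappa> \<nu> \<longrightarrow> family_condition lam \<mu> \<kappa> \<nu>))"
proof (intro conjI impI iffI)
  show "power_condition lam \<mu> \<kappa> \<nu>" if "family_condition lam \<mu> \<kappa> \<nu>"
    \<comment> \<open>The constant family with value the initial interval space on \<mu> itself has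
      carrier type \<open>'m\<close>.\<close>
    using family_imp_product_condition[where 'x = 'm, OF assms(1,2,3,6) that]
      initial_interval_not_bracket_compact[OF assms(3,4)]
    unfolding product_condition_def power_condition_def by simp
  show "family_condition lam \<mu> \<kappa> \<nu>" if "power_condition lam \<mu> \<kappa> \<nu>"
    by (rule power_imp_family_condition[OF assms(1,3,6) that])
  show "product_condition TYPE('x) lam \<mu> \<kappa> \<nu>" if "family_condition lam \<mu> \<kappa> \<nu>"
    by (rule family_imp_product_condition[OF assms(1,2,3,6) that])
  assume le: "|Field \<mu>| \<le>o |UNIV :: 'x set|" and prod: "product_condition TYPE('x) lam \<mu> \<kappa> \<nu>"
  obtain h :: "'m \<Rightarrow> 'x" where h: "inj_on h (Field \<mu>)"
    using le card_of_ordLeq[of "Field \<mu>" "UNIV :: 'x set"] by blast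
  \<comment> \<open>The cardinal \<open>\<mu>'\<close> is some minimal well-order of the image of
    \<open>h\<close>, not the transported relation; having the same cardinality is enough for an
    order isomorphism with \<mu>.\<close>
  define \<mu>' where "\<mu>' = |h ` Field \<mu>|"
  have iso: "\<mu> =o \<mu>'"
    unfolding \<mu>'_def
  proof (rule ordIso_transitive)
    show "\<mu> =o |Field \<mu>|"
      using ordIso_symmetric[OF card_of_Field_ordIso] assms(3) by blast
    show "|Field \<mu>| =o |h ` Field \<mu>|"
      by (rule card_of_ordIsoI[OF inj_on_imp_bij_betw[OF h]])
  qed
  have \<mu>': "Cinfinite \<mu>'" "regularCard \<mu>'"
    using Cinfinite_cong[OF iso] regularCard_ordIso[OF iso] assms(3,4) by simp_all
  \<comment> \<open>The space is built from \<open>\<mu>'\<close>, but (b) asks for failure of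
    compactness with respect to \<mu>, hence the change of cardinal.\<close>
  have "\<not> bracket_compact \<mu> \<mu> (initial_interval_topology \<mu>')"
    using initial_interval_not_bracket_compact[OF \<mu>'] bracket_compact_ordIso[OF iso] by blast
  then have "power_condition lam \<mu>' \<kappa> \<nu>"
    using prod unfolding product_condition_def power_condition_def by simp
  then show "family_condition lam \<mu> \<kappa> \<nu>"
    by (rule family_condition_ordIso[OF iso power_imp_family_condition[OF assms(1) \<mu>'(1) assms(6)]])
qed

end
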